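(* Let $G$ be a finite simple graph on $n\leq 4$ vertices. Then $\operatorname{dmg}(G;2)=1$ if and only if $G$ is not (isomorphic to) one of the graphs in $\{P_2,\ P_4,\ C_4,\ \overline{K_1},\ \overline{K_3},\ \overline{K_4},\ K_2\cup K_2,\ K_2\cup K_1 \cup K_1\}$.
   Context: All graphs are finite, undirected and simple, have at least one vertex, and need not be connected. $P_m$, $C_m$, $K_m$ denote the path, cycle and complete graph on $m$ vertices, $\overline{K_m}$ the graph with $m$ vertices and no edges, and $\cup$ denotes disjoint union of graphs. The game with one cop and $s$ robbers on a graph $G$ is a perfect-information game. In round $0$ the cop chooses an initial vertex, and then each robber chooses an initial vertex (several robbers may share a vertex). Each subsequent round consists of a turn for the cop followed by a turn for the robbers; on their turn, each player may stay put or move to a neighboring vertex (on the robbers' turn every uncaptured robber may do so). Whenever the cop occupies the same vertex as one or more robbers, all those robbers are captured and take no further part in the game. If a robber occupies a vertex $v$ at the end of some round (including round $0$) and that robber is not captured in the following round, then $v$ becomes damaged (and stays damaged). The robbers aim to maximize, and the cop aims to minimize, the total number of damaged vertices. The $s$-robber damage number $\operatorname{dmg}(G;s)$ is the number of vertices damaged under optimal play, i.e. the smallest $d$ such that the cop has a strategy guaranteeing that at most $d$ vertices are ever damaged, whatever the $s$ robbers do. *)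

theory Defs
  imports "Graph_Theory.Pair_Digraph" "Graph_Theory.Digraph_Isomorphism"
begin

text \<open>
  A finite simple graph is a \<^locale>\<open>pair_graph\<close>: finite vertex set, symmetric and loop-free
  set of arcs. An undirected edge is represented by the two arcs between its end points.
\<close>

abbreviation isomorphic :: "'a pair_pre_digraph \<Rightarrow> 'b pair_pre_digraph \<Rightarrow> bool" (infix \<open>\<cong>\<close> 50) where
  "G \<cong> H \<equiv> digraph_iso (with_proj G) (with_proj H)"

definition path_graph :: "nat \<Rightarrow> nat pair_pre_digraph" where
  "path_graph m = \<lparr> pverts = {..<m},
     parcs = {(i, j). i < m \<and> j < m \<and> (j = Suc i \<or> i = Suc j)} \<rparr>"

text \<open>Meaningful for \<open>m \<ge> 3\<close> only.\<close>

definition cycle_graph :: "nat \<Rightarrow> nat pair_pre_digraph" where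
  "cycle_graph m = \<lparr> pverts = {..<m},
     parcs = {(i, j). i < m \<and> j < m \<and> (j = Suc i mod m \<or> i = Suc j mod m)} \<rparr>"

definition complete_graph :: "nat \<Rightarrow> nat pair_pre_digraph" where
  "complete_graph m = \<lparr> pverts = {..<m}, parcs = {(i, j). i < m \<and> j < m \<and> i \<noteq> j} \<rparr>"

definition edgeless_graph :: "nat \<Rightarrow> nat pair_pre_digraph" where
  "edgeless_graph m = \<lparr> pverts = {..<m}, parcs = {} \<rparr>"

definition disjoint_union ::
    "'a pair_pre_digraph \<Rightarrow> 'b pair_pre_digraph \<Rightarrow> ('a + 'b) pair_pre_digraph" (infixl \<open>\<uplus>\<close> 65) where
  "G \<uplus> H = \<lparr> pverts = pverts G <+> pverts H,
     parcs = map_prod Inl Inl ` parcs G \<union> map_prod Inr Inr ` parcs H \<rparr>"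

definition closed_nbhd :: "'a pair_pre_digraph \<Rightarrow> 'a \<Rightarrow> 'a set" where
  "closed_nbhd G v = insert v {w. (v, w) \<in> parcs G}"

text \<open>
  The state of a robber is \<open>Some v\<close> while it is at large on \<open>v\<close>, and \<open>None\<close> once it is captured.
  A configuration is the list of the states of all robbers at the end of a round.

  \<open>settle c v\<close> is the state of a robber that goes to \<open>v\<close> while the cop is on \<open>c\<close>: entering the
  cop's vertex means capture.
\<close>

definition settle :: "'a \<Rightarrow> 'a \<Rightarrow> 'a option" where
  "settle c v = (if v = c then None else Some v)"

text \<open>
  \<open>robber_round G c x y\<close>: a robber in state \<open>x\<close> at the end of one round can be in state \<open>y\<close> at the
  end of the next one, if the cop's turn in that next round takes (or leaves) the cop to \<open>c\<close>.
\<close>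

fun robber_round :: "'a pair_pre_digraph \<Rightarrow> 'a \<Rightarrow> 'a option \<Rightarrow> 'a option \<Rightarrow> bool" where
  "robber_round G c None y \<longleftrightarrow> y = None"
| "robber_round G c (Some v) y \<longleftrightarrow>
     (if v = c then y = None else \<exists>w \<in> closed_nbhd G v. y = settle c w)"

text \<open>
  A cop strategy maps the list of the configurations at the ends of rounds \<open>0, \<dots>, t - 1\<close> to the
  vertex of the cop after its turn in round \<open>t\<close>; the empty list yields the initial vertex.
  The cop's own earlier positions are determined by the strategy and this history.
\<close>

definition cop_strategy :: "'a pair_pre_digraph \<Rightarrow> ('a option list list \<Rightarrow> 'a) \<Rightarrow> bool" where
  "cop_strategy G \<sigma> \<longleftrightarrow>
     \<sigma> [] \<in> pverts G \<and> (\<forall>h \<rho>. \<sigma> (h @ [\<rho>]) \<in> closed_nbhd G (\<sigma> h))"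

text \<open>\<open>robber_play G s \<sigma> R\<close>: \<open>R t\<close> is the configuration at the end of round \<open>t\<close> in a possible
  (infinite) play of \<open>s\<close> robbers against the cop strategy \<open>\<sigma>\<close>.\<close>

definition robber_play ::
    "'a pair_pre_digraph \<Rightarrow> nat \<Rightarrow> ('a option list list \<Rightarrow> 'a) \<Rightarrow> (nat \<Rightarrow> 'a option list) \<Rightarrow> bool" where
  "robber_play G s \<sigma> R \<longleftrightarrow>
     length (R 0) = s \<and>
     (\<forall>x \<in> set (R 0). \<exists>v \<in> pverts G. x = settle (\<sigma> []) v) \<and>
     (\<forall>t. list_all2 (robber_round G (\<sigma> (map R [0..<Suc t]))) (R t) (R (Suc t)))"

definition damaged :: "(nat \<Rightarrow> 'a option list) \<Rightarrow> 'a set" where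
  "damaged R = {v. \<exists>t. \<exists>i < length (R t). R t ! i = Some v \<and> R (Suc t) ! i \<noteq> None}"

definition dmg :: "'a pair_pre_digraph \<Rightarrow> nat \<Rightarrow> nat" where
  "dmg G s = (LEAST d. \<exists>\<sigma>. cop_strategy G \<sigma> \<and>
     (\<forall>R. robber_play G s \<sigma> R \<longrightarrow> card (damaged R) \<le> d))"

end

(* The cop wins (at most one damaged vertex) when it can start on a vertex c adjacent to
   all other vertices but at most one, which is isolated. The critical case is that of two robbers on
   distinct neighbours u and v of c: as there is at most one further vertex, the cop can choose which
   of them to capture, say u, in such a way that every neighbour of v is dominated by u. The other
   robber either moves and is captured at once, or stays, and then the cop returns to c. A robber who
   sits on the isolated vertex damages nothing else.
   If every vertex c has two non-neighbours, or has a non-neighbour d that has a neighbour w outside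
   the closed neighbourhood of some other vertex v, then the robbers can damage two vertices: they
   start on the two non-neighbours and stay, or on d and v; in the latter case the cop has to capture
   the robber on v, while the other one moves from d to w and is not reached in the next round.
   On at most four vertices this fails to happen, and a suitable c exists, except for the listed
   graphs; of these, only the connected ones on at most two vertices have damage number 0. *)

theory Submission
  imports Defs
begin

section \<open>Plays and lower bounds\<close>

text \<open>One movement rule \<open>mv\<close> prescribes a whole play: every robber that survives
  the cop's turn follows it. The recursion builds entire histories, since the cop's reply
  \<open>\<sigma>\<close> depends on all earlier configurations.\<close>

lemma robber_play_exists:
  assumes "length \<rho> = s" and "\<forall>x\<in>set \<rho>. \<exists>v\<in>pverts G. x = settle (\<sigma> []) v"
    and mv: "\<And>t v. mv t v \<in> closed_nbhd G v"
  obtains R where "robber_play G s \<sigma> R" and "R 0 = \<rho>"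
    and "\<And>t i v. i < s \<Longrightarrow> R t ! i = Some v \<Longrightarrow>
      R (Suc t) ! i = (if v = \<sigma> (map R [0..<Suc t]) then None
        else settle (\<sigma> (map R [0..<Suc t])) (mv t v))"
proof -
  define next_state where "next_state c t x = (case x of None \<Rightarrow> None
      | Some v \<Rightarrow> if v = c then None else settle c (mv t v))" for c t x
  define H where "H t = rec_nat [\<rho>]
      (\<lambda>t h. h @ [map (next_state (\<sigma> h) t) (last h)]) t" for t
  define R where "R t = last (H t)" for t
  have H: "H t = map R [0..<Suc t]" for t
    by (induction t) (auto simp: H_def R_def)
  have R_Suc: "R (Suc t) = map (next_state (\<sigma> (map R [0..<Suc t])) t) (R t)" for t
    unfolding H[symmetric] by (simp add: R_def H_def)
  have R_0: "R 0 = \<rho>" by (simp add: R_def H_def)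
  have len: "length (R t) = s" for t
    by (induction t) (simp_all add: R_0 R_Suc assms(1) del: upt_Suc)
  have legal: "robber_round G c x (next_state c t x)" for c t x
    using mv by (auto simp: next_state_def split: option.split)
  have "robber_play G s \<sigma> R"
    unfolding robber_play_def
    using assms R_0 len legal by (auto simp: R_Suc list_all2_conv_all_nth simp del: upt_Suc)
  moreover note R_0
  moreover have "R (Suc t) ! i = (if v = \<sigma> (map R [0..<Suc t]) then None
        else settle (\<sigma> (map R [0..<Suc t])) (mv t v))"
    if "i < s" "R t ! i = Some v" for t i v
    using that len by (simp add: R_Suc next_state_def del: upt_Suc)
  ultimately show thesis using that by blast
qed

lemma list_all2_set_subset:
  assumes "list_all2 P xs ys" and "set xs \<subseteq> A" and "\<And>x y. P x y \<Longrightarrow> x \<in> A \<Longrightarrow> y \<in> B"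
  shows "set ys \<subseteq> B"
  using assms(1,2) by (induction rule: list_all2_induct) (auto intro: assms(3))

lemma length_robber_play:
  assumes "robber_play G s \<sigma> R"
  shows "length (R t) = s"
proof (induction t)
  case 0
  show ?case using assms by (simp add: robber_play_def)
next
  case (Suc t)
  have "list_all2 (robber_round G (\<sigma> (map R [0..<Suc t]))) (R t) (R (Suc t))"
    using assms by (simp add: robber_play_def)
  then show ?case using Suc list_all2_lengthD by fastforce
qed

lemma damagedI:
  "i < length (R t) \<Longrightarrow> R t ! i = Some v \<Longrightarrow> R (Suc t) ! i \<noteq> None \<Longrightarrow> v \<in> damaged R"
  by (auto simp: damaged_def)

text \<open>Both alternatives are opening positions against a cop starting on \<open>c\<close>. In
  the second, \<open>v\<close> may lie within the cop's reach, but a cop lured there cannot follow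
  the other robber from \<open>d\<close> to \<open>w\<close>.\<close>

definition two_damageable_from :: "'a pair_pre_digraph \<Rightarrow> 'a \<Rightarrow> bool" where
  "two_damageable_from G c \<longleftrightarrow>
    (\<exists>u\<in>pverts G. \<exists>v\<in>pverts G. u \<noteq> v \<and> u \<notin> closed_nbhd G c \<and> v \<notin> closed_nbhd G c) \<or>
    (\<exists>d\<in>pverts G. \<exists>v\<in>pverts G. \<exists>w\<in>pverts G. d \<notin> closed_nbhd G c \<and> v \<noteq> c \<and> v \<noteq> d \<and>
      (d, w) \<in> parcs G \<and> w \<notin> closed_nbhd G v)"

context pair_graph
begin

lemma arc_sym: "(u, v) \<in> parcs G \<Longrightarrow> (v, u) \<in> parcs G"
  using pair_sym_arcs by (simp add: symmetric_def sym_def)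

lemma closed_nbhd_sym: "v \<in> closed_nbhd G u \<longleftrightarrow> u \<in> closed_nbhd G v"
  by (auto simp: closed_nbhd_def arc_sym)

lemma damaged_subset_pverts:
  assumes "robber_play G s \<sigma> R"
  shows "damaged R \<subseteq> pverts G"
proof -
  have "set (R t) \<subseteq> insert None (Some ` pverts G)" for t
  proof (induction t)
    case 0
    then show ?case using assms by (fastforce simp: robber_play_def settle_def split: if_splits)
  next
    case (Suc t)
    have "list_all2 (robber_round G (\<sigma> (map R [0..<Suc t]))) (R t) (R (Suc t))"
      using assms by (auto simp: robber_play_def)
    then show ?case
      using Suc
    proof (rule list_all2_set_subset)
      fix x y assume "robber_round G (\<sigma> (map R [0..<Suc t])) x y" "x \<in> insert None (Some ` pverts G)"
      then show "y \<in> insert None (Some ` pverts G)"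
        using in_arcsD2 by (fastforce simp: settle_def closed_nbhd_def split: if_splits)
    qed
  qed
  moreover have "Some v \<in> set (R t)" if "i < length (R t)" "R t ! i = Some v" for t i v
    using that nth_mem by metis
  ultimately show ?thesis
    unfolding damaged_def by blast
qed

lemma finite_damaged: "robber_play G s \<sigma> R \<Longrightarrow> finite (damaged R)"
  by (rule finite_subset[OF damaged_subset_pverts pair_finite_verts])

text \<open>The \<open>LEAST\<close> is attained because some bound exists: a cop who never moves
  concedes at most all vertices. Moreover, being a bound is monotone in \<open>d\<close>.\<close>

lemma dmg_le_iff:
  assumes "pverts G \<noteq> {}"
  shows "dmg G s \<le> d \<longleftrightarrow>
    (\<exists>\<sigma>. cop_strategy G \<sigma> \<and> (\<forall>R. robber_play G s \<sigma> R \<longrightarrow> card (damaged R) \<le> d))"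
    (is "_ \<longleftrightarrow> ?P d")
proof
  obtain c where "c \<in> pverts G" using assms by blast
  then have "cop_strategy G (\<lambda>_. c)"
    by (simp add: cop_strategy_def closed_nbhd_def)
  then have "?P (card (pverts G))"
    using card_mono[OF pair_finite_verts damaged_subset_pverts] by blast
  then have *: "?P (dmg G s)"
    unfolding dmg_def by (rule LeastI)
  assume "dmg G s \<le> d"
  then show "?P d" using * le_trans by blast
next
  assume "?P d"
  then show "dmg G s \<le> d" unfolding dmg_def by (rule Least_le)
qed

section \<open>Lower bounds from explicit robber strategies\<close>

lemma stationary_robbers:
  assumes "u \<in> pverts G" "v \<in> pverts G" "u \<noteq> \<sigma> []" "v \<noteq> \<sigma> []"
  obtains R where "robber_play G 2 \<sigma> R"
    and "{u, v} - {\<sigma> [[Some u, Some v]]} \<subseteq> damaged R"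
proof -
  obtain R where R: "robber_play G 2 \<sigma> R" "R 0 = [Some u, Some v]"
    and step: "\<And>t i w. i < 2 \<Longrightarrow> R t ! i = Some w \<Longrightarrow>
      R (Suc t) ! i = (if w = \<sigma> (map R [0..<Suc t]) then None
        else settle (\<sigma> (map R [0..<Suc t])) w)"
    by (rule robber_play_exists[of "[Some u, Some v]" 2 G \<sigma> "\<lambda>_ v. v"])
      (use assms in \<open>auto simp: settle_def closed_nbhd_def\<close>)
  \<comment> \<open>Round 1 suffices: a robber missed by the cop's first move after the opening
    damages its initial vertex.\<close>
  have "w \<in> damaged R" if "w \<noteq> \<sigma> [[Some u, Some v]]" "i < 2" "R 0 ! i = Some w" for w i
    using step[OF that(2,3)] that R(2)
    by (intro damagedI[of i R 0]) (auto simp: settle_def)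
  from this[of _ 0] this[of _ 1] show thesis
    by (intro that[OF R(1)]) (auto simp: R(2))
qed

text \<open>Two stationary robbers suffice: the cop's first move hits at most one of two distinct
  vertices, and no vertex outside the closed neighbourhood of the start. In the latter case both
  robbers may share the vertex \<open>u\<close>.\<close>

lemma dmg_ge_oneI:
  assumes "pverts G \<noteq> {}"
    and "\<And>c. c \<in> pverts G \<Longrightarrow>
      \<exists>u\<in>pverts G. \<exists>v\<in>pverts G. u \<noteq> c \<and> v \<noteq> c \<and> (u \<noteq> v \<or> u \<notin> closed_nbhd G c)"
  shows "1 \<le> dmg G 2"
proof -
  have "\<not> dmg G 2 \<le> 0"
  proof
    assume "dmg G 2 \<le> 0"
    then obtain \<sigma> where \<sigma>: "cop_strategy G \<sigma>"
      and none: "\<And>R. robber_play G 2 \<sigma> R \<Longrightarrow> card (damaged R) \<le> 0"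
      unfolding dmg_le_iff[OF assms(1)] by blast
    obtain u v where uv: "u \<in> pverts G" "v \<in> pverts G" "u \<noteq> \<sigma> []" "v \<noteq> \<sigma> []"
        "u \<noteq> v \<or> u \<notin> closed_nbhd G (\<sigma> [])"
      using assms(2) \<sigma> unfolding cop_strategy_def by metis
    obtain R where R: "robber_play G 2 \<sigma> R" "{u, v} - {\<sigma> [[Some u, Some v]]} \<subseteq> damaged R"
      using stationary_robbers[where \<sigma> = \<sigma>] uv by metis
    have "\<sigma> [[Some u, Some v]] \<in> closed_nbhd G (\<sigma> [])"
      using \<sigma> unfolding cop_strategy_def by (metis append_Nil)
    then have "damaged R \<noteq> {}" using R(2) uv(5) by auto
    then show False using none[OF R(1)] finite_damaged[OF R(1)] by simp
  qed
  then show ?thesis by simp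
qed

text \<open>As \<open>\<sigma>\<close> is fixed, the robbers can plan with the cop's reply to their
  opening known: they stand still unless that reply captures the robber on \<open>v\<close>.\<close>

lemma two_damageable_from_play:
  assumes \<sigma>: "cop_strategy G \<sigma>" and "two_damageable_from G (\<sigma> [])"
  obtains R where "robber_play G 2 \<sigma> R" "2 \<le> card (damaged R)"
proof -
  note result = that
  have move: "\<sigma> (h @ [\<rho>]) \<in> closed_nbhd G (\<sigma> h)" for h \<rho>
    using \<sigma> by (simp add: cop_strategy_def)
  have cop: "\<sigma> [\<rho>] \<in> closed_nbhd G (\<sigma> [])" "\<sigma> [\<rho>, \<rho>'] \<in> closed_nbhd G (\<sigma> [\<rho>])" for \<rho> \<rho>'
    using move[of "[]" \<rho>] move[of "[\<rho>]" \<rho>'] by simp_all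
  have two: "2 \<le> card (damaged R)" if "robber_play G 2 \<sigma> R" "{u, v} \<subseteq> damaged R" "u \<noteq> v" for R u v
    using card_mono[OF finite_damaged that(2), of 2 \<sigma>] that by simp
  have stat: thesis if uv: "u \<in> pverts G" "v \<in> pverts G" "u \<noteq> \<sigma> []" "v \<noteq> \<sigma> []" "u \<noteq> v"
      "\<sigma> [[Some u, Some v]] \<notin> {u, v}" for u v
  proof -
    obtain R where "robber_play G 2 \<sigma> R" "{u, v} - {\<sigma> [[Some u, Some v]]} \<subseteq> damaged R"
      using stationary_robbers[where \<sigma> = \<sigma>] uv by metis
    then show thesis using two[of R u v] uv result by auto
  qed
  from assms(2) consider
      u v where "u \<in> pverts G" "v \<in> pverts G" "u \<noteq> v"
        "u \<notin> closed_nbhd G (\<sigma> [])" "v \<notin> closed_nbhd G (\<sigma> [])"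
    | d v w where "d \<in> pverts G" "v \<in> pverts G" "d \<notin> closed_nbhd G (\<sigma> [])" "v \<noteq> \<sigma> []" "v \<noteq> d"
        "(d, w) \<in> parcs G" "w \<notin> closed_nbhd G v"
    unfolding two_damageable_from_def by blast
  then show thesis
  proof cases
    case 1
    then show thesis
      using cop(1)[of "[Some u, Some v]"] by (intro stat[of u v]) (auto simp: closed_nbhd_def)
  next
    case 2
    let ?\<rho> = "[Some d, Some v]"
    have d: "d \<noteq> \<sigma> []" "\<sigma> [?\<rho>] \<noteq> d"
      using 2 cop(1)[of ?\<rho>] by (auto simp: closed_nbhd_def)
    show thesis
    proof (cases "\<sigma> [?\<rho>] = v")
      case False
      then show thesis using 2 d by (intro stat[of d v]) auto
    next
      case True
      \<comment> \<open>Index 0 is the robbers' turn in round 1: the robber on \<open>d\<close> goes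
        to \<open>w\<close> there and stays put ever after.\<close>
      define mv where "mv = (\<lambda>(t::nat) x. if t = 0 \<and> x = d then w else x)"
      obtain R where R: "robber_play G 2 \<sigma> R" "R 0 = ?\<rho>"
        and step: "\<And>t i x. i < 2 \<Longrightarrow> R t ! i = Some x \<Longrightarrow>
          R (Suc t) ! i = (if x = \<sigma> (map R [0..<Suc t]) then None
            else settle (\<sigma> (map R [0..<Suc t])) (mv t x))"
        by (rule robber_play_exists[of ?\<rho> 2 G \<sigma> mv])
          (use 2 d in \<open>auto simp: settle_def closed_nbhd_def mv_def\<close>)
      have len: "length (R 0) = 2" "length (R 1) = 2"
        using length_robber_play[OF R(1)] by auto
      have "w \<noteq> v" using 2 by (auto simp: closed_nbhd_def)
      then have R1: "R 1 ! 0 = Some w"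
        using step[of 0 0 d] R(2) True 2 by (simp add: mv_def settle_def)
      \<comment> \<open>In round 2 the cop moves from \<open>v\<close>, whose closed neighbourhood
        misses \<open>w\<close>.\<close>
      have "\<sigma> [R 0, R 1] \<noteq> w"
        using cop(2)[of ?\<rho> "R 1"] R(2) True 2 by auto
      then have R2: "R 2 ! 0 = Some w"
        using step[of 0 1 w] R1 by (simp add: mv_def settle_def numeral_2_eq_2)
      have "d \<in> damaged R"
        using R1 R(2) by (intro damagedI[of 0 R 0]) auto
      moreover have "w \<in> damaged R"
        using R1 R2 len by (intro damagedI[of 0 R 1]) (auto simp: numeral_2_eq_2)
      moreover have "d \<noteq> w" using 2 no_loops' by blast
      ultimately show thesis using two[OF R(1), of d w] result[OF R(1)] by simp
    qed
  qed
qed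

lemma dmg_ge_twoI:
  assumes "pverts G \<noteq> {}" and "\<And>c. c \<in> pverts G \<Longrightarrow> two_damageable_from G c"
  shows "2 \<le> dmg G 2"
proof -
  have "\<not> dmg G 2 \<le> 1"
  proof
    assume "dmg G 2 \<le> 1"
    then obtain \<sigma> where \<sigma>: "cop_strategy G \<sigma>"
      and le: "\<And>R. robber_play G 2 \<sigma> R \<Longrightarrow> card (damaged R) \<le> 1"
      unfolding dmg_le_iff[OF assms(1)] by blast
    then have "two_damageable_from G (\<sigma> [])" using assms(2) by (simp add: cop_strategy_def)
    then obtain R where "robber_play G 2 \<sigma> R" "2 \<le> card (damaged R)"
      using two_damageable_from_play \<sigma> by metis
    then show False using le by fastforce
  qed
  then show ?thesis by simp
qed

text \<open>The cop starts on \<open>c\<close> and moves to \<open>z\<close>, the only place where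
  robbers can be at large, so all are captured in round 1. The case \<open>c = z\<close> is included
  and covers the one-vertex graph.\<close>

lemma dmg_eq_zeroI:
  assumes V: "pverts G = {c, z}" and "z \<in> closed_nbhd G c"
  shows "dmg G s = 0"
proof -
  define \<sigma> :: "'a option list list \<Rightarrow> 'a" where "\<sigma> h = (if h = [] then c else z)" for h
  have "cop_strategy G \<sigma>"
    using assms by (auto simp: cop_strategy_def \<sigma>_def closed_nbhd_def)
  moreover have "card (damaged R) \<le> 0" if R: "robber_play G s \<sigma> R" for R
  proof -
    have step: "list_all2 (robber_round G z) (R t) (R (Suc t))" for t
      using R by (simp add: robber_play_def \<sigma>_def)
    have gone: "set (R (Suc t)) \<subseteq> {None}" if "set (R t) \<subseteq> {None, Some z}" for t
      using step[of t] that by (rule list_all2_set_subset) auto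
    have "set (R t) \<subseteq> {None, Some z}" for t
    proof (induction t)
      case 0
      then show ?case using R V by (fastforce simp: robber_play_def \<sigma>_def settle_def split: if_splits)
    next
      case (Suc t)
      then show ?case using gone by blast
    qed
    then have "set (R (Suc t)) \<subseteq> {None}" for t using gone by blast
    then have "R (Suc t) ! i = None" if "i < length (R t)" for t i
      using that nth_mem[of i "R (Suc t)"] length_robber_play[OF R] by (metis singletonD subsetD)
    then have "damaged R = {}"
      by (auto simp: damaged_def)
    then show ?thesis by simp
  qed
  ultimately have "dmg G s \<le> 0"
    using dmg_le_iff[of s 0] V by blast
  then show ?thesis by simp
qed

end

section \<open>The chase\<close>

definition at_large :: "'a option list \<Rightarrow> 'a set" where
  "at_large \<rho> = {v. Some v \<in> set \<rho>}"

context pair_graph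
begin

text \<open>After the capture of \<open>u\<close>, any other robber that was within reach of \<open>p\<close> must stay put
  in order to escape the cop.\<close>

definition good_capture :: "'a \<Rightarrow> 'a set \<Rightarrow> 'a \<Rightarrow> bool" where
  "good_capture p X u \<longleftrightarrow> u \<in> X \<inter> closed_nbhd G p \<and>
    (\<forall>v \<in> X \<inter> closed_nbhd G p. v \<noteq> u \<longrightarrow> (\<forall>w. (v, w) \<in> parcs G \<longrightarrow> w \<in> closed_nbhd G u))"

text \<open>The cop's next vertex when standing on \<open>p\<close> with the occupied vertices
  \<open>X\<close>: a good capture has priority, then the return to the base \<open>c\<close>.
  Staying on \<open>p\<close> is the default that keeps the move legal.\<close>

definition chase :: "'a \<Rightarrow> 'a \<Rightarrow> 'a set \<Rightarrow> 'a" where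
  "chase c p X = (if \<exists>u. good_capture p X u then SOME u. good_capture p X u
    else if c \<in> closed_nbhd G p then c else p)"

lemma good_capture_chase: "good_capture p X u \<Longrightarrow> good_capture p X (chase c p X)"
  unfolding chase_def by (metis someI)

lemma chase_in_closed_nbhd: "chase c p X \<in> closed_nbhd G p"
proof (cases "\<exists>u. good_capture p X u")
  case True
  then show ?thesis using good_capture_chase unfolding good_capture_def by blast
next
  case False
  then show ?thesis by (simp add: chase_def closed_nbhd_def)
qed

text \<open>With only one occupied vertex in reach, the condition on other robbers is vacuous, so
  capturing there is the unique good capture.\<close>

lemma chase_single:
  assumes "X \<inter> closed_nbhd G p = {z}"
  shows "chase c p X = z"
proof -
  have "good_capture p X z" using assms by (auto simp: good_capture_def)
  then have "good_capture p X (chase c p X)" by (rule good_capture_chase)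
  then show ?thesis using assms by (auto simp: good_capture_def)
qed

lemma chase_none: "X \<inter> closed_nbhd G p = {} \<Longrightarrow> c \<in> closed_nbhd G p \<Longrightarrow> chase c p X = c"
  by (auto simp: chase_def good_capture_def)

definition isolated :: "'a \<Rightarrow> bool" where
  "isolated v \<longleftrightarrow> (\<forall>w. (v, w) \<notin> parcs G)"

text \<open>If capturing on \<open>u\<close> is bad, then \<open>v\<close> has a neighbour
  \<open>w\<close> not dominated by \<open>u\<close>, and \<open>c\<close>, \<open>u\<close>,
  \<open>v\<close>, \<open>w\<close> are all the vertices. Neighbours of \<open>u\<close> can then
  only be \<open>c\<close> and \<open>v\<close>, both dominated by \<open>v\<close>, so capturing on
  \<open>v\<close> is good.\<close>

lemma good_capture_exists:
  assumes "card (pverts G) \<le> 4" and "c \<in> pverts G"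
    and "u \<in> closed_nbhd G c" "v \<in> closed_nbhd G c" "u \<noteq> c" "v \<noteq> c" "u \<noteq> v"
  shows "\<exists>x. good_capture c {u, v} x"
proof (cases "good_capture c {u, v} u")
  case False
  then obtain w where w: "(v, w) \<in> parcs G" "w \<notin> closed_nbhd G u"
    using assms by (auto simp: good_capture_def)
  have arcs: "(c, u) \<in> parcs G" "(c, v) \<in> parcs G"
    using assms by (auto simp: closed_nbhd_def)
  have distinct: "w \<noteq> u" "w \<noteq> v" "w \<noteq> c"
    using w arcs arc_sym no_loops' by (auto simp: closed_nbhd_def)
  have "pverts G = {c, u, v, w}"
  proof (rule sym, rule card_seteq)
    show "finite (pverts G)" by (rule pair_finite_verts)
    show "{c, u, v, w} \<subseteq> pverts G" using arcs w in_arcsD1 in_arcsD2 by blast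
    show "card (pverts G) \<le> card {c, u, v, w}" using assms distinct by auto
  qed
  then have "x \<in> closed_nbhd G v" if "(u, x) \<in> parcs G" for x
    using in_arcsD2[OF that] that w arcs arc_sym no_loops' by (auto simp: closed_nbhd_def)
  then have "good_capture c {u, v} v" using assms by (auto simp: good_capture_def)
  then show ?thesis ..
qed blast

text \<open>An invariant of the chase under which only \<open>m\<close> can still be damaged. It is stated for the end of
  a round: the cop, who started on \<open>c\<close>, is on \<open>p\<close>. In case \<open>returning\<close> only the robber with
  index \<open>j\<close> is left, which matters since two robbers on \<open>m\<close> could separate.\<close>

inductive contained :: "'a \<Rightarrow> 'a \<Rightarrow> 'a \<Rightarrow> 'a option list \<Rightarrow> bool" for c m where
  lone: "contained c m p \<rho>"
    if "p \<notin> at_large \<rho>" "z \<in> closed_nbhd G p"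
      "\<forall>x \<in> at_large \<rho>. x = z \<or> x = m \<and> isolated m"
| returning: "contained c m p \<rho>"
    if "p \<notin> at_large \<rho>" "at_large \<rho> \<subseteq> {m}" "m \<in> closed_nbhd G c" "p \<in> closed_nbhd G c"
      "\<forall>i < length \<rho>. i \<noteq> j \<longrightarrow> \<rho> ! i = None"
| pair: "contained c m c \<rho>"
    if "c \<notin> at_large \<rho>" "length \<rho> = 2" "m \<in> closed_nbhd G c" "m \<noteq> u" "at_large \<rho> = {u, m}"
      "u = chase c c (at_large \<rho>)" "good_capture c (at_large \<rho>) u"

lemma contained_cop_free: "contained c m p \<rho> \<Longrightarrow> p \<notin> at_large \<rho>"
  by (induction rule: contained.induct)

text \<open>If the robbers in reach of \<open>c\<close> occupy at most one vertex,
  \<open>lone\<close> holds with \<open>m\<close> the possible isolated vertex \<open>d\<close>.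
  Otherwise \<open>m\<close> is the robber vertex that the first chase move leaves alone.\<close>

lemma contained_initial:
  assumes "card (pverts G) \<le> 4" and c: "c \<in> pverts G"
    and dom: "\<And>x. x \<in> pverts G \<Longrightarrow> x \<notin> closed_nbhd G c \<Longrightarrow> x = d \<and> isolated d"
    and \<rho>: "length \<rho> = 2" "at_large \<rho> \<subseteq> pverts G - {c}"
  shows "\<exists>m. contained c m c \<rho>"
proof (cases "\<exists>z. at_large \<rho> \<inter> closed_nbhd G c \<subseteq> {z}")
  case True
  then obtain z where z: "at_large \<rho> \<inter> closed_nbhd G c \<subseteq> {z}" by blast
  \<comment> \<open>With no robber in reach, \<open>z\<close> may be arbitrary. The default
    \<open>c\<close> works since \<open>lone\<close> does not require its \<open>z\<close> to be
    occupied.\<close>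
  define z' where "z' = (if z \<in> closed_nbhd G c then z else c)"
  have "z' \<in> closed_nbhd G c" by (simp add: z'_def closed_nbhd_def)
  moreover have "\<forall>x \<in> at_large \<rho>. x = z' \<or> x = d \<and> isolated d"
    using z dom \<rho>(2) by (auto simp: z'_def)
  ultimately have "contained c d c \<rho>"
    using \<rho>(2) by (intro lone[of _ _ z']) auto
  then show ?thesis ..
next
  case False
  then obtain u where u: "u \<in> at_large \<rho>" "u \<in> closed_nbhd G c" by blast
  with False obtain v where v: "v \<in> at_large \<rho>" "v \<in> closed_nbhd G c" "v \<noteq> u" by blast
  obtain a b where "\<rho> = [a, b]" using \<rho>(1)
    by (auto simp: length_Suc_conv numeral_2_eq_2)
  then have X: "at_large \<rho> = {u, v}" using u v by (auto simp: at_large_def)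
  then obtain x where "good_capture c (at_large \<rho>) x"
    using good_capture_exists[of c u v] assms(1) c u v \<rho>(2) by auto
  then obtain t where t: "t = chase c c (at_large \<rho>)" "good_capture c (at_large \<rho>) t"
    using good_capture_chase by blast
  then have "t \<in> {u, v}" unfolding X good_capture_def by blast
  then obtain m where m: "m \<in> {u, v}" "m \<noteq> t" "at_large \<rho> = {t, m}"
    using X v(3) by blast
  moreover have "c \<notin> at_large \<rho>" "m \<in> closed_nbhd G c" using m(1) u v \<rho>(2) by blast+
  ultimately have "contained c m c \<rho>"
    using t \<rho>(1) pair by metis
  then show ?thesis ..
qed

text \<open>Every vertex from which a robber does damage in the coming round lies in
  \<open>at_large \<rho> - {p'}\<close>. The case \<open>pair\<close> leads to
  \<open>returning\<close> or \<open>lone\<close>, \<open>returning\<close> leads to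
  \<open>lone\<close>, and \<open>lone\<close> persists.\<close>

lemma contained_step:
  assumes "contained c m p \<rho>" and p': "p' = chase c p (at_large \<rho>)"
    and dom: "\<And>x. x \<in> pverts G \<Longrightarrow> x \<notin> closed_nbhd G c \<Longrightarrow> isolated x"
    and step: "list_all2 (robber_round G p') \<rho> \<rho>'"
  shows "at_large \<rho> - {p'} \<subseteq> {m}" and "contained c m p' \<rho>'"
proof -
  have len: "length \<rho>' = length \<rho>" using step list_all2_lengthD by metis
  have round: "robber_round G p' (\<rho> ! i) (\<rho>' ! i)" if "i < length \<rho>" for i
    using step that by (simp add: list_all2_conv_all_nth)
  have from_robber: "\<exists>v \<in> at_large \<rho> - {p'}. x \<in> closed_nbhd G v \<and> x \<noteq> p'"
    if x: "x \<in> at_large \<rho>'" for x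
  proof -
    obtain i where i: "i < length \<rho>" "\<rho>' ! i = Some x"
      using x len by (auto simp: at_large_def in_set_conv_nth)
    then obtain v where v: "\<rho> ! i = Some v" using round[OF i(1)] by (cases "\<rho> ! i") auto
    then have "v \<in> at_large \<rho>" using i by (auto simp: at_large_def in_set_conv_nth)
    moreover have "v \<noteq> p'" "x \<in> closed_nbhd G v" "x \<noteq> p'"
      using round[OF i(1)] i v by (auto simp: settle_def split: if_splits)
    ultimately show ?thesis by blast
  qed
  have free: "p' \<notin> at_large \<rho>'" using from_robber by blast
  have self: "p' \<in> closed_nbhd G p'" by (simp add: closed_nbhd_def)
  have single: "\<exists>z. at_large \<rho>' \<subseteq> {z}" if "\<forall>i < length \<rho>. i \<noteq> j \<longrightarrow> \<rho>' ! i = None" for j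
  proof -
    have "x = the (\<rho>' ! j)" if x: "x \<in> at_large \<rho>'" for x
    proof -
      obtain i where i: "i < length \<rho>" "\<rho>' ! i = Some x"
        using x len by (auto simp: at_large_def in_set_conv_nth)
      then have "i = j" using \<open>\<forall>i < length \<rho>. i \<noteq> j \<longrightarrow> \<rho>' ! i = None\<close> by force
      then show ?thesis using i by simp
    qed
    then show ?thesis by blast
  qed
  \<comment> \<open>No robber is left, so the cop's own vertex serves as the \<open>z\<close> of
    \<open>lone\<close>.\<close>
  have dead: "contained c m p' \<rho>'" if "at_large \<rho> - {p'} \<subseteq> {}"
    using from_robber that free by (intro lone[OF _ self]) auto
  have p_free: "p \<notin> at_large \<rho>" using assms(1) by (rule contained_cop_free)
  from assms(1) have "at_large \<rho> - {p'} \<subseteq> {m} \<and> contained c m p' \<rho>'"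
  proof cases
    case (lone z)
    \<comment> \<open>An isolated \<open>m\<close> without the cop on it is out of reach, so
      \<open>z\<close> is the only target.\<close>
    have "p' = z" if "z \<in> at_large \<rho>"
    proof -
      have "at_large \<rho> \<inter> closed_nbhd G p = {z}"
        using lone that p_free arc_sym unfolding closed_nbhd_def isolated_def by blast
      then show ?thesis using chase_single p' by blast
    qed
    then have stuck: "x = m \<and> isolated m" if "x \<in> at_large \<rho> - {p'}" for x
      using lone(3) that by auto
    then have "x = m \<and> isolated m" if "x \<in> at_large \<rho>'" for x
      using from_robber[OF that] by (auto simp: closed_nbhd_def isolated_def)
    then have "contained c m p' \<rho>'" using free by (intro contained.lone[OF _ self]) auto
    then show ?thesis using stuck by blast
  next
    case (returning j)
    show ?thesis
    proof (cases "at_large \<rho> - {p'} = {}")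
      case True
      then show ?thesis using dead by blast
    next
      case False
      then have X: "at_large \<rho> = {m}" "p' \<noteq> m" using returning(2) by auto
      \<comment> \<open>A robber on \<open>m\<close> within reach would be captured now; being out
        of reach, it lets the cop go home to \<open>c\<close>.\<close>
      have "m \<notin> closed_nbhd G p"
      proof
        assume "m \<in> closed_nbhd G p"
        then have "at_large \<rho> \<inter> closed_nbhd G p = {m}" using X(1) by blast
        then show False using chase_single p' X(2) by blast
      qed
      then have "at_large \<rho> \<inter> closed_nbhd G p = {}" using X(1) by simp
      moreover have "c \<in> closed_nbhd G p" using returning(4) closed_nbhd_sym by blast
      ultimately have "p' = c" unfolding p' by (rule chase_none)
      have "\<forall>i < length \<rho>. i \<noteq> j \<longrightarrow> \<rho>' ! i = None"
        using returning(5) round by fastforce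
      then obtain z where z: "at_large \<rho>' \<subseteq> {z}" using single by blast
      \<comment> \<open>A neighbour of \<open>m\<close> is not isolated, hence dominated by
        \<open>c\<close>: wherever the last robber goes, it is in reach of the cop back on
        \<open>c\<close>.\<close>
      have "x \<in> closed_nbhd G p'" if x: "x \<in> at_large \<rho>'" for x
      proof -
        have "x \<in> closed_nbhd G m" using from_robber[OF x] X(1) by auto
        then have "x = m \<or> (x, m) \<in> parcs G" using arc_sym by (auto simp: closed_nbhd_def)
        then show ?thesis
          using \<open>p' = c\<close> returning(3) dom[of x] in_arcsD1 unfolding isolated_def by blast
      qed
      then have "contained c m p' \<rho>'"
        \<comment> \<open>If no robber is left, nothing is known about \<open>z\<close>, and
          \<open>p'\<close> takes its place.\<close>
        using z free self by (intro contained.lone[of _ _ "if at_large \<rho>' = {} then p' else z"]) auto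
      then show ?thesis using X by blast
    qed
  next
    case (pair u)
    then have "p' = u" using p' by metis
    note start = pair(1,3-6,8)[folded \<open>p' = u\<close>]
    obtain i where i: "i < 2" "\<rho> ! i = Some p'"
      using start(2,5) by (auto simp: at_large_def in_set_conv_nth set_eq_iff)
    \<comment> \<open>Robber \<open>i\<close> has just been captured; as \<open>i < 2\<close>, the
      index of the other one is \<open>1 - i\<close>.\<close>
    then have "\<forall>k < length \<rho>. k \<noteq> 1 - i \<longrightarrow> \<rho>' ! k = None"
      using round[of i] start(2) by (auto simp: less_2_cases_iff)
    then obtain z where z: "at_large \<rho>' \<subseteq> {z}" using single by blast
    have m_good: "w \<in> closed_nbhd G p'" if "(m, w) \<in> parcs G" for w
      using start that unfolding good_capture_def by blast
    have near: "x = m \<or> x \<in> closed_nbhd G p'" if x: "x \<in> at_large \<rho>'" for x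
      using from_robber[OF x] start(5) m_good by (auto simp: closed_nbhd_def)
    have "contained c m p' \<rho>'"
    \<comment> \<open>Either the survivor stayed on \<open>m\<close> (or is gone), or it moved to a
      vertex dominated by the cop, where the next chase move captures it.\<close>
    proof (cases "at_large \<rho>' \<subseteq> {m}")
      case True
      moreover have "p' \<in> closed_nbhd G c" using start(6) by (simp add: good_capture_def)
      ultimately show ?thesis
        using free start(3) len \<open>\<forall>k < length \<rho>. k \<noteq> 1 - i \<longrightarrow> \<rho>' ! k = None\<close>
        by (intro returning[of _ _ _ _ "1 - i"]) auto
    next
      case False
      then have "z \<in> closed_nbhd G p'" using z near by blast
      then show ?thesis using free z by (intro contained.lone[of _ _ z]) auto
    qed
    then show ?thesis using start(5) by blast
  qed
  then show "at_large \<rho> - {p'} \<subseteq> {m}" and "contained c m p' \<rho>'" by (rule conjunct1, rule conjunct2)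
qed

text \<open>The robbers' opening determines \<open>m\<close>; from then on \<open>contained\<close>
  holds at the end of each round, so nothing but \<open>m\<close> is damaged.\<close>

lemma dmg_le_oneI:
  assumes "card (pverts G) \<le> 4" and c: "c \<in> pverts G"
    and dom: "\<And>x. x \<in> pverts G \<Longrightarrow> x \<notin> closed_nbhd G c \<Longrightarrow> x = d \<and> isolated d"
  shows "dmg G 2 \<le> 1"
proof -
  \<comment> \<open>Folding over the history recovers the cop's current position, which
    \<open>chase\<close> needs.\<close>
  define \<sigma> where "\<sigma> = foldl (\<lambda>p \<rho>. chase c p (at_large \<rho>)) c"
  have "cop_strategy G \<sigma>"
    using c by (simp add: cop_strategy_def \<sigma>_def chase_in_closed_nbhd)
  moreover have "card (damaged R) \<le> 1" if R: "robber_play G 2 \<sigma> R" for R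
  proof -
    have len: "length (R 0) = 2" and init: "\<forall>x\<in>set (R 0). \<exists>v\<in>pverts G. x = settle c v"
      and play: "\<And>t. list_all2 (robber_round G (\<sigma> (map R [0..<Suc t]))) (R t) (R (Suc t))"
      using R by (simp_all add: robber_play_def \<sigma>_def)
    have move: "\<sigma> (map R [0..<Suc t]) = chase c (\<sigma> (map R [0..<t])) (at_large (R t))" for t
      by (simp add: \<sigma>_def)
    have "at_large (R 0) \<subseteq> pverts G - {c}"
      using init by (fastforce simp: at_large_def settle_def split: if_splits)
    then obtain m where m: "contained c m c (R 0)"
      using contained_initial[OF assms(1) c dom] len by blast
    have dom': "\<And>x. x \<in> pverts G \<Longrightarrow> x \<notin> closed_nbhd G c \<Longrightarrow> isolated x"
      using dom by blast
    have inv: "contained c m (\<sigma> (map R [0..<t])) (R t)" for t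
    proof (induction t)
      case 0
      then show ?case using m by (simp add: \<sigma>_def)
    next
      case (Suc t)
      then show ?case using contained_step(2)[OF _ move dom' play] by blast
    qed
    have "v = m" if v: "i < length (R t)" "R t ! i = Some v" "R (Suc t) ! i \<noteq> None" for v i t
    proof -
      have "robber_round G (\<sigma> (map R [0..<Suc t])) (R t ! i) (R (Suc t) ! i)"
        using play v(1) by (simp add: list_all2_conv_all_nth)
      then have "v \<noteq> \<sigma> (map R [0..<Suc t])"
        using v by auto
      moreover have "v \<in> at_large (R t)"
        using v by (metis at_large_def mem_Collect_eq nth_mem)
      ultimately show ?thesis using contained_step(1)[OF inv move dom' play] by blast
    qed
    then have "damaged R \<subseteq> {m}" by (auto simp: damaged_def)
    then show ?thesis using card_mono[of "{m}"] by simp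
  qed
  ultimately show ?thesis
    using dmg_le_iff[of 2 1] c by blast
qed

end

section \<open>Isomorphisms and the exceptional graphs\<close>

text \<open>Of the library's isomorphism only the vertex map is kept, inverted so that the concrete
  vertices of \<open>H\<close> name those of \<open>G\<close>.\<close>

lemma isomorphicE:
  assumes "G \<cong> H"
  obtains g where "inj_on g (pverts H)" "pverts G = g ` pverts H"
    and "\<And>x y. x \<in> pverts H \<Longrightarrow> y \<in> pverts H \<Longrightarrow> (g x, g y) \<in> parcs G \<longleftrightarrow> (x, y) \<in> parcs H"
proof -
  from assms obtain h where h: "pre_digraph.digraph_isomorphism (with_proj G) h"
    and H: "with_proj H = app_iso h (with_proj G)"
    unfolding digraph_iso_def by blast
  interpret pair_wf_digraph G
    using h unfolding pre_digraph.digraph_isomorphism_def wf_digraph_wp_iff by blast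
  define f where "f = iso_verts h"
  have inj: "inj_on f (pverts G)"
    using h unfolding pre_digraph.digraph_isomorphism_def f_def by simp
  have V: "pverts H = f ` pverts G"
    using arg_cong[OF H, of verts] by (simp add: f_def)
  \<comment> \<open>Tail and head in \<open>with_proj H\<close> are the projections, which forces
    \<open>iso_arcs h\<close> to act on arcs as \<open>f\<close> does on both end points.\<close>
  have proj: "fst = iso_tail h" "snd = iso_head h"
    using arg_cong[OF H, of tail] arg_cong[OF H, of head] by simp_all
  have "iso_arcs h a = (f (fst a), f (snd a))" if "a \<in> parcs G" for a
    using h that unfolding pre_digraph.digraph_isomorphism_def f_def
    by (auto simp: proj[symmetric] prod_eq_iff)
  then have A: "parcs H = (\<lambda>(x, y). (f x, f y)) ` parcs G"
    using arg_cong[OF H, of arcs] by (force simp: image_iff)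
  define g where "g = the_inv_into (pverts G) f"
  have fg: "f (g y) = y" "g y \<in> pverts G" if "y \<in> pverts H" for y
    using that V inj by (auto simp: g_def the_inv_into_f_f)
  have gf: "g (f x) = x" if "x \<in> pverts G" for x
    using that inj by (simp add: g_def the_inv_into_f_f)
  show thesis
  proof
    show "inj_on g (pverts H)" using fg(1) by (rule inj_on_inverseI)
    show "pverts G = g ` pverts H" using V gf by force
    show "(g x, g y) \<in> parcs G \<longleftrightarrow> (x, y) \<in> parcs H" if "x \<in> pverts H" "y \<in> pverts H" for x y
    proof
      assume "(g x, g y) \<in> parcs G"
      then show "(x, y) \<in> parcs H" unfolding A using fg that by (intro image_eqI[of _ _ "(g x, g y)"]) auto
    next
      assume "(x, y) \<in> parcs H"
      then obtain a b where "(a, b) \<in> parcs G" "x = f a" "y = f b" unfolding A by auto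
      then show "(g x, g y) \<in> parcs G" using gf in_arcsD1 in_arcsD2 by simp
    qed
  qed
qed

text \<open>The isomorphism is the inverse of \<open>g\<close>, applied componentwise to arcs. As
  \<open>H\<close> is a bare record, its arcs have to be confined to its vertices by
  assumption.\<close>

lemma (in pair_wf_digraph) isomorphicI:
  assumes inj: "inj_on g (pverts H)" and V: "pverts G = g ` pverts H"
    and A: "\<forall>x\<in>pverts H. \<forall>y\<in>pverts H. (g x, g y) \<in> parcs G \<longleftrightarrow> (x, y) \<in> parcs H"
    and H: "parcs H \<subseteq> pverts H \<times> pverts H"
  shows "G \<cong> H"
proof -
  define f where "f = the_inv_into (pverts H) g"
  have fg: "f (g x) = x" if "x \<in> pverts H" for x
    using that inj by (simp add: f_def the_inv_into_f_f)
  have gf: "g (f x) = x" "f x \<in> pverts H" if "x \<in> pverts G" for x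
    using that V fg by auto
  have inj_f: "inj_on f (pverts G)" using gf(1) by (rule inj_on_inverseI)
  define h :: "('a, 'a \<times> 'a, 'b, 'b \<times> 'b) digraph_isomorphism" where
    "h = \<lparr> iso_verts = f, iso_arcs = map_prod f f, iso_head = snd, iso_tail = fst \<rparr>"
  have "inj_on (map_prod f f) (pverts G \<times> pverts G)"
    using inj_f by (rule map_prod_inj_on[OF inj_f])
  then have inj_arcs: "inj_on (map_prod f f) (parcs G)"
    by (rule inj_on_subset) (use wellformed' in auto)
  have "wf_digraph (with_proj G)" ..
  then have "pre_digraph.digraph_isomorphism (with_proj G) h"
    using inj_f inj_arcs by (simp add: pre_digraph.digraph_isomorphism_def h_def)
  moreover have "with_proj H = app_iso h (with_proj G)"
  proof -
    have "pverts H = f ` pverts G" using V fg by force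
    moreover have "parcs H = map_prod f f ` parcs G"
    proof (intro subset_antisym subsetI)
      fix a assume "a \<in> parcs H"
      then obtain x y where a: "a = (x, y)" "x \<in> pverts H" "y \<in> pverts H" "(x, y) \<in> parcs H"
        using H by (cases a) auto
      then have "(g x, g y) \<in> parcs G" using A by blast
      then have "map_prod f f (g x, g y) \<in> map_prod f f ` parcs G" by (rule imageI)
      then show "a \<in> map_prod f f ` parcs G" using a fg by simp
    next
      fix a assume "a \<in> map_prod f f ` parcs G"
      then obtain x y where xy: "(x, y) \<in> parcs G" "a = (f x, f y)" by auto
      then have "x \<in> pverts G" "y \<in> pverts G" using wellformed' by blast+
      then show "a \<in> parcs H" using A[rule_format, of "f x" "f y"] xy gf by simp
    qed
    ultimately show ?thesis by (simp add: app_iso_def with_proj_def h_def)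
  qed
  ultimately show ?thesis unfolding digraph_iso_def by blast
qed

section \<open>Two damaged vertices in the exceptional graphs on at least three vertices\<close>

lemma two_damageable_from_image:
  assumes inj: "inj_on g (pverts H)" and V: "pverts G = g ` pverts H"
    and A: "\<And>x y. x \<in> pverts H \<Longrightarrow> y \<in> pverts H \<Longrightarrow> (g x, g y) \<in> parcs G \<longleftrightarrow> (x, y) \<in> parcs H"
    and c: "c \<in> pverts H" "two_damageable_from H c"
  shows "two_damageable_from G (g c)"
proof -
  have N: "g x \<in> closed_nbhd G (g y) \<longleftrightarrow> x \<in> closed_nbhd H y" if "x \<in> pverts H" "y \<in> pverts H" for x y
    using that A[of y x] inj_on_eq_iff[OF inj] by (auto simp: closed_nbhd_def)
  from c(2) show ?thesis
    unfolding two_damageable_from_def V bex_simps(7) using c(1)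
    by (simp add: N A inj_on_eq_iff[OF inj] cong: conj_cong bex_cong)
qed

lemma two_damageable_from_iso:
  assumes "G \<cong> H" and "\<forall>c\<in>pverts H. two_damageable_from H c" and "c \<in> pverts G"
  shows "two_damageable_from G c"
  using assms by (elim isomorphicE) (auto intro: two_damageable_from_image)

lemma two_damageable_from_farI:
  assumes "u \<in> pverts G" "v \<in> pverts G" "u \<noteq> v" "u \<noteq> c" "v \<noteq> c" "(c, u) \<notin> parcs G" "(c, v) \<notin> parcs G"
  shows "two_damageable_from G c"
  using assms by (auto simp: two_damageable_from_def closed_nbhd_def)

lemma two_damageable_from_nearI:
  assumes "d \<in> pverts G" "v \<in> pverts G" "w \<in> pverts G" "d \<noteq> c" "v \<noteq> c" "v \<noteq> d" "w \<noteq> v"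
    "(c, d) \<notin> parcs G" "(d, w) \<in> parcs G" "(v, w) \<notin> parcs G"
  shows "two_damageable_from G c"
  unfolding two_damageable_from_def closed_nbhd_def using assms by blast

lemma two_damageable_from_edgeless:
  assumes "3 \<le> m"
  shows "two_damageable_from (edgeless_graph m) c"
proof -
  have "\<exists>u v :: nat. u < 3 \<and> v < 3 \<and> u \<noteq> v \<and> u \<noteq> c \<and> v \<noteq> c"
    by presburger
  then obtain u v where "u < 3" "v < 3" "u \<noteq> v" "u \<noteq> c" "v \<noteq> c" by blast
  then show ?thesis
    using assms by (intro two_damageable_from_farI[of u _ v]) (auto simp: edgeless_graph_def)
qed

text \<open>From an end, two vertices are out of reach. From an inner vertex only the far end
  \<open>d\<close> is; then \<open>v\<close> is the near end, and \<open>w\<close> the other inner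
  vertex.\<close>

lemma two_damageable_from_path_4:
  assumes "c \<in> pverts (path_graph 4)"
  shows "two_damageable_from (path_graph 4) c"
proof -
  consider "c = 0" | "c = 1" | "c = 2" | "c = 3" using assms by (force simp: path_graph_def)
  then show ?thesis
  proof cases
    case 1
    then show ?thesis by (intro two_damageable_from_farI[of 2 _ 3]) (auto simp: path_graph_def)
  next
    case 2
    then show ?thesis by (intro two_damageable_from_nearI[of 3 _ 0 2]) (auto simp: path_graph_def)
  next
    case 3
    then show ?thesis by (intro two_damageable_from_nearI[of 0 _ 3 1]) (auto simp: path_graph_def)
  next
    case 4
    then show ?thesis by (intro two_damageable_from_farI[of 0 _ 1]) (auto simp: path_graph_def)
  qed
qed

text \<open>Here \<open>d\<close> is the antipode of \<open>c\<close>, while \<open>v\<close> and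
  \<open>w\<close> are the neighbours of \<open>c\<close>, antipodal to each other.\<close>

lemma two_damageable_from_cycle_4:
  assumes "c \<in> pverts (cycle_graph 4)"
  shows "two_damageable_from (cycle_graph 4) c"
proof -
  consider "c = 0" | "c = 1" | "c = 2" | "c = 3" using assms by (force simp: cycle_graph_def)
  then show ?thesis
  proof cases
    case 1
    then show ?thesis by (intro two_damageable_from_nearI[of 2 _ 1 3]) (auto simp: cycle_graph_def)
  next
    case 2
    then show ?thesis by (intro two_damageable_from_nearI[of 3 _ 2 0]) (auto simp: cycle_graph_def)
  next
    case 3
    then show ?thesis by (intro two_damageable_from_nearI[of 0 _ 3 1]) (auto simp: cycle_graph_def)
  next
    case 4
    then show ?thesis by (intro two_damageable_from_nearI[of 1 _ 0 2]) (auto simp: cycle_graph_def)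
  qed
qed

lemma two_damageable_from_two_edges:
  "two_damageable_from (complete_graph 2 \<uplus> complete_graph 2) c"
proof (cases c)
  case (Inl i)
  then show ?thesis
    by (intro two_damageable_from_farI[of "Inr 0" _ "Inr 1"])
      (auto simp: complete_graph_def disjoint_union_def)
next
  case (Inr i)
  then show ?thesis
    by (intro two_damageable_from_farI[of "Inl 0" _ "Inl 1"])
      (auto simp: complete_graph_def disjoint_union_def)
qed

lemma two_damageable_from_edge_and_two_points:
  assumes "c \<in> pverts (complete_graph 2 \<uplus> complete_graph 1 \<uplus> complete_graph 1)"
  shows "two_damageable_from (complete_graph 2 \<uplus> complete_graph 1 \<uplus> complete_graph 1) c"
proof -
  consider i where "c = Inl (Inl i)" | "c = Inl (Inr 0)" | "c = Inr 0"
    using assms by (auto simp: complete_graph_def disjoint_union_def)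
  then show ?thesis
  proof cases
    case 1
    then show ?thesis
      by (intro two_damageable_from_farI[of "Inl (Inr 0)" _ "Inr 0"])
        (auto simp: complete_graph_def disjoint_union_def)
  next
    case 2
    then show ?thesis
      by (intro two_damageable_from_farI[of "Inl (Inl 0)" _ "Inr 0"])
        (auto simp: complete_graph_def disjoint_union_def)
  next
    case 3
    then show ?thesis
      by (intro two_damageable_from_farI[of "Inl (Inl 0)" _ "Inl (Inr 0)"])
        (auto simp: complete_graph_def disjoint_union_def)
  qed
qed

section \<open>Recognising the exceptional graphs\<close>

lemma parcs_subset_pverts:
  "parcs (path_graph m) \<subseteq> pverts (path_graph m) \<times> pverts (path_graph m)"
  "parcs (cycle_graph m) \<subseteq> pverts (cycle_graph m) \<times> pverts (cycle_graph m)"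
  "parcs (complete_graph m) \<subseteq> pverts (complete_graph m) \<times> pverts (complete_graph m)"
  "parcs (edgeless_graph m) \<subseteq> pverts (edgeless_graph m) \<times> pverts (edgeless_graph m)"
  by (auto simp: path_graph_def cycle_graph_def complete_graph_def edgeless_graph_def)

lemma parcs_subset_pverts_disjoint_union:
  "parcs G \<subseteq> pverts G \<times> pverts G \<Longrightarrow> parcs H \<subseteq> pverts H \<times> pverts H \<Longrightarrow>
    parcs (G \<uplus> H) \<subseteq> pverts (G \<uplus> H) \<times> pverts (G \<uplus> H)"
  by (fastforce simp: disjoint_union_def)

lemma disjoint_union_simps:
  "pverts (G \<uplus> H) = Inl ` pverts G \<union> Inr ` pverts H"
  "(Inl x, Inl x') \<in> parcs (G \<uplus> H) \<longleftrightarrow> (x, x') \<in> parcs G"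
  "(Inr y, Inr y') \<in> parcs (G \<uplus> H) \<longleftrightarrow> (y, y') \<in> parcs H"
  "(Inl x, Inr y') \<notin> parcs (G \<uplus> H)"
  "(Inr y, Inl x') \<notin> parcs (G \<uplus> H)"
  by (auto simp: disjoint_union_def)

lemma lessThan_small: "{..<Suc 0} = {0}" "{..<2} = {0, 1 :: nat}" "{..<4} = {0, 1, 2, 3 :: nat}"
  by auto

context pair_graph
begin

lemma iso_edgeless:
  assumes "parcs G = {}"
  shows "G \<cong> edgeless_graph (card (pverts G))"
proof -
  obtain g where "bij_betw g {..<card (pverts G)} (pverts G)"
    using ex_bij_betw_nat_finite[OF pair_finite_verts] by (auto simp: atLeast0LessThan)
  then show ?thesis
    using assms by (intro isomorphicI[of g]) (auto simp: edgeless_graph_def bij_betw_def)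
qed

lemma iso_path_2:
  assumes "pverts G = {a, b}" "(a, b) \<in> parcs G"
  shows "G \<cong> path_graph 2"
proof -
  have "(b, a) \<in> parcs G" "(a, a) \<notin> parcs G" "(b, b) \<notin> parcs G" "a \<noteq> b"
    using assms arc_sym no_loops' by blast+
  then show ?thesis
    using assms by (intro isomorphicI[OF _ _ _ parcs_subset_pverts(1), of "\<lambda>i. [a, b] ! i"])
      (simp_all add: path_graph_def lessThan_small)
qed

text \<open>The common non-edges \<open>bc\<close> and \<open>ad\<close> are the diagonals of the
  quadrilateral \<open>a\<close>, \<open>b\<close>, \<open>d\<close>, \<open>c\<close>; the four
  claims differ in which sides other than \<open>ab\<close> are present.\<close>

lemma iso_four_vertices:
  assumes V: "pverts G = {a, b, c, d}" and "distinct [a, b, c, d]"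
    and ab: "(a, b) \<in> parcs G" and bc: "(b, c) \<notin> parcs G" and ad: "(a, d) \<notin> parcs G"
  shows "(a, c) \<in> parcs G \<Longrightarrow> (b, d) \<in> parcs G \<Longrightarrow> (c, d) \<in> parcs G \<Longrightarrow> G \<cong> cycle_graph 4"
    and "(a, c) \<in> parcs G \<Longrightarrow> (b, d) \<in> parcs G \<Longrightarrow> (c, d) \<notin> parcs G \<Longrightarrow> G \<cong> path_graph 4"
    and "(a, c) \<notin> parcs G \<Longrightarrow> (b, d) \<notin> parcs G \<Longrightarrow> (c, d) \<in> parcs G \<Longrightarrow>
      G \<cong> complete_graph 2 \<uplus> complete_graph 2"
    and "(a, c) \<notin> parcs G \<Longrightarrow> (b, d) \<notin> parcs G \<Longrightarrow> (c, d) \<notin> parcs G \<Longrightarrow>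
      G \<cong> complete_graph 2 \<uplus> complete_graph 1 \<uplus> complete_graph 1"
proof -
  have sym: "(x, y) \<in> parcs G \<longleftrightarrow> (y, x) \<in> parcs G" for x y using arc_sym by blast
  have loop: "(x, x) \<notin> parcs G" for x using no_loops' by blast
  have ne: "a \<noteq> b" "a \<noteq> c" "a \<noteq> d" "b \<noteq> c" "b \<noteq> d" "c \<noteq> d" using assms(2) by auto
  \<comment> \<open>The instances of \<open>sym\<close> are oriented towards alphabetical order, so
    that rewriting with them terminates.\<close>
  note facts = V ab bc ad loop ne ne[symmetric]
    sym[of b a] sym[of c a] sym[of d a] sym[of c b] sym[of d b] sym[of d c]
  { assume "(a, c) \<in> parcs G" "(b, d) \<in> parcs G" "(c, d) \<in> parcs G"
    then show "G \<cong> cycle_graph 4"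
      by (intro isomorphicI[OF _ _ _ parcs_subset_pverts(2), of "\<lambda>i. [a, b, d, c] ! i"])
        (simp_all add: facts cycle_graph_def lessThan_small insert_commute) }
  { assume "(a, c) \<in> parcs G" "(b, d) \<in> parcs G" "(c, d) \<notin> parcs G"
    then show "G \<cong> path_graph 4"
      by (intro isomorphicI[OF _ _ _ parcs_subset_pverts(1), of "\<lambda>i. [c, a, b, d] ! i"])
        (simp_all add: facts path_graph_def lessThan_small insert_commute) }
  { assume "(a, c) \<notin> parcs G" "(b, d) \<notin> parcs G" "(c, d) \<in> parcs G"
    then show "G \<cong> complete_graph 2 \<uplus> complete_graph 2"
      by (intro isomorphicI[where g = "case_sum (\<lambda>i. [a, b] ! i) (\<lambda>i. [c, d] ! i)"]
          parcs_subset_pverts_disjoint_union parcs_subset_pverts)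
        (simp_all add: facts disjoint_union_simps ball_Un complete_graph_def lessThan_small insert_commute) }
  { assume "(a, c) \<notin> parcs G" "(b, d) \<notin> parcs G" "(c, d) \<notin> parcs G"
    then show "G \<cong> complete_graph 2 \<uplus> complete_graph 1 \<uplus> complete_graph 1"
      by (intro isomorphicI[where g = "case_sum (case_sum (\<lambda>i. [a, b] ! i) (\<lambda>_. c)) (\<lambda>_. d)"]
          parcs_subset_pverts_disjoint_union parcs_subset_pverts)
        (simp_all add: facts disjoint_union_simps ball_Un complete_graph_def lessThan_small insert_commute) }
qed

text \<open>An edgeless graph on at most two vertices has a suitable start, which leaves three or
  four vertices. Any edge forces four vertices; then a vertex of degree at least two leads to the
  path or the cycle, and otherwise the edges form a matching.\<close>

lemma exceptional_if_no_dominating_start: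
  assumes "pverts G \<noteq> {}" and "card (pverts G) \<le> 4"
    and nodom: "\<And>c d. c \<in> pverts G \<Longrightarrow> \<exists>x\<in>pverts G. x \<notin> closed_nbhd G c \<and> \<not> (x = d \<and> isolated d)"
  shows "G \<cong> path_graph 4 \<or> G \<cong> cycle_graph 4 \<or> G \<cong> edgeless_graph 3 \<or> G \<cong> edgeless_graph 4 \<or>
       G \<cong> complete_graph 2 \<uplus> complete_graph 2 \<or>
       G \<cong> complete_graph 2 \<uplus> complete_graph 1 \<uplus> complete_graph 1"
proof (cases "parcs G = {}")
  case True
  obtain c where c: "c \<in> pverts G" using assms(1) by blast
  have "\<not> card (pverts G) \<le> 2"
  proof
    assume "card (pverts G) \<le> 2"
    then have "card (pverts G - {c}) \<le> 1" using c pair_finite_verts by simp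
    then obtain d where "pverts G - {c} \<subseteq> {d}"
      by (metis card_le_Suc0_iff_eq One_nat_def finite_Diff pair_finite_verts insertI1 subsetI singletonI)
    moreover have "isolated d" using True by (simp add: isolated_def)
    ultimately show False using nodom[OF c, of d] by (auto simp: closed_nbhd_def)
  qed
  then have "card (pverts G) = 3 \<or> card (pverts G) = 4" using assms(2) by linarith
  then show ?thesis using iso_edgeless[OF True] by metis
next
  case False
  then obtain e where "e \<in> parcs G" by blast
  then obtain a b where ab: "(a, b) \<in> parcs G" by (cases e) blast
  \<comment> \<open>With \<open>d = c\<close> this yields just a non-neighbour of \<open>c\<close>;
    with \<open>d\<close> the only non-neighbour, it says that \<open>d\<close> is not
    isolated.\<close>
  have non_nbr: "\<exists>x\<in>pverts G. x \<noteq> c \<and> (c, x) \<notin> parcs G \<and> (x = d \<longrightarrow> (\<exists>w. (d, w) \<in> parcs G))"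
    if "c \<in> pverts G" for c d
    using nodom[OF that, of d] by (auto simp: closed_nbhd_def isolated_def)
  have four: "\<exists>c d. pverts G = {a, b, c, d} \<and> distinct [a, b, c, d]" if ab: "(a, b) \<in> parcs G" for a b
  proof -
    have V: "a \<in> pverts G" "b \<in> pverts G" "a \<noteq> b" using ab in_arcsD1 in_arcsD2 no_loops' by blast+
    obtain c where c: "c \<in> pverts G" "c \<noteq> a" "(a, c) \<notin> parcs G" "c \<noteq> b"
      using non_nbr[OF V(1)] ab by metis
    have "\<exists>d\<in>pverts G. d \<noteq> a \<and> d \<noteq> b \<and> d \<noteq> c"
    \<comment> \<open>On three vertices \<open>c\<close> would be the only non-neighbour of
      \<open>a\<close>, hence not isolated and adjacent to \<open>b\<close>; but then
      \<open>b\<close> dominates everything.\<close>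
    proof (rule ccontr)
      assume "\<not> ?thesis"
      then have V': "x = a \<or> x = b \<or> x = c" if "x \<in> pverts G" for x using that by blast
      obtain w where w: "(c, w) \<in> parcs G" using non_nbr[OF V(1), of c] V' ab by metis
      then have "w = b" using V'[OF in_arcsD2[OF w]] c(3) arc_sym no_loops' by metis
      then show False using non_nbr[OF V(2), of b] V' w ab arc_sym by metis
    qed
    then obtain d where d: "d \<in> pverts G" "d \<noteq> a" "d \<noteq> b" "d \<noteq> c" by blast
    have "pverts G = {a, b, c, d}"
    proof (rule sym, rule card_seteq)
      show "finite (pverts G)" by (rule pair_finite_verts)
      show "{a, b, c, d} \<subseteq> pverts G" using V c(1) d(1) by simp
      show "card (pverts G) \<le> card {a, b, c, d}" using assms(2) V c d by auto
    qed
    then show ?thesis using V c d by auto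
  qed
  show ?thesis
  proof (cases "\<exists>a b c. (a, b) \<in> parcs G \<and> (a, c) \<in> parcs G \<and> b \<noteq> c")
    case True
    then obtain a b c where arcs: "(a, b) \<in> parcs G" "(a, c) \<in> parcs G" "b \<noteq> c" by blast
    obtain x y where xy: "pverts G = {a, b, x, y}" "distinct [a, b, x, y]" using four[OF arcs(1)] by blast
    have "c \<noteq> a" using arcs(2) no_loops' by blast
    moreover have "c \<in> {a, b, x, y}" using in_arcsD2[OF arcs(2)] xy(1) by simp
    ultimately have "c = x \<or> c = y" using arcs(3) by blast
    then obtain d where V: "pverts G = {a, b, c, d}" "distinct [a, b, c, d]"
    proof
      assume "c = x"
      then show thesis using that[of y] xy by simp
    next
      assume "c = y"
      moreover have "{a, b, x, y} = {a, b, y, x}" by blast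
      ultimately show thesis using that[of x] xy by auto
    qed
    \<comment> \<open>As \<open>a\<close> is adjacent to \<open>b\<close> and \<open>c\<close>, its
      only non-neighbour is \<open>d\<close>, which therefore is not isolated.\<close>
    have ad: "(a, d) \<notin> parcs G" using non_nbr[of a a] V arcs by auto
    obtain w where w: "(d, w) \<in> parcs G" using non_nbr[of a d] V arcs by auto
    \<comment> \<open>Stated for arbitrary \<open>b\<close> and \<open>c\<close>, so that the case
      where \<open>d\<close> is adjacent to \<open>c\<close> follows by exchanging them. As
      \<open>b\<close> is adjacent to \<open>a\<close> and \<open>d\<close>, its non-neighbour must
      be \<open>c\<close>.\<close>
    have cyc: ?thesis if "pverts G = {a, b, c, d}" "distinct [a, b, c, d]" "(a, b) \<in> parcs G"
        "(a, c) \<in> parcs G" "(a, d) \<notin> parcs G" "(b, d) \<in> parcs G" for b c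
    proof -
      have bc: "(b, c) \<notin> parcs G" using non_nbr[of b b] that arc_sym[OF that(3)] by auto
      note iso = iso_four_vertices(1,2)[OF that(1-3) bc that(5,4,6)]
      show ?thesis by (cases "(c, d) \<in> parcs G") (use iso in blast)+
    qed
    have "w \<noteq> a" using w ad arc_sym by blast
    moreover have "w \<noteq> d" using w no_loops' by blast
    ultimately have "w = b \<or> w = c" using in_arcsD2[OF w] V(1) by simp
    then show ?thesis
    proof
      assume "w = b"
      then show ?thesis using cyc[OF V arcs(1,2) ad] arc_sym[OF w] by simp
    next
      assume "w = c"
      moreover have "pverts G = {a, c, b, d}" "distinct [a, c, b, d]" using V by auto
      ultimately show ?thesis using cyc[OF _ _ arcs(2,1) ad] arc_sym[OF w] by simp
    qed
  next
    case False
    \<comment> \<open>All degrees are at most one, so the edge \<open>ab\<close> is a component and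
      only \<open>cd\<close> is undecided.\<close>
    then have deg: "x = y" if "(v, x) \<in> parcs G" "(v, y) \<in> parcs G" for v x y using that by blast
    obtain c d where V: "pverts G = {a, b, c, d}" "distinct [a, b, c, d]" using four[OF ab] by blast
    have "(a, c) \<notin> parcs G" "(a, d) \<notin> parcs G" "(b, c) \<notin> parcs G" "(b, d) \<notin> parcs G"
      using deg[OF ab] deg[OF arc_sym[OF ab]] V(2) by auto
    note iso = iso_four_vertices(3,4)[OF V ab this(3,2,1,4)]
    show ?thesis by (cases "(c, d) \<in> parcs G") (use iso in blast)+
  qed
qed

end

theorem proposition4p2:
  fixes G :: "'a pair_pre_digraph"
  assumes "pair_graph G" and "pverts G \<noteq> {}" and "card (pverts G) \<le> 4"
  shows "dmg G 2 = 1 \<longleftrightarrow>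
    \<not> (G \<cong> path_graph 2 \<or> G \<cong> path_graph 4 \<or> G \<cong> cycle_graph 4 \<or>
       G \<cong> edgeless_graph 1 \<or> G \<cong> edgeless_graph 3 \<or> G \<cong> edgeless_graph 4 \<or>
       G \<cong> complete_graph 2 \<uplus> complete_graph 2 \<or>
       G \<cong> complete_graph 2 \<uplus> complete_graph 1 \<uplus> complete_graph 1)"
    (is "_ \<longleftrightarrow> \<not> (?P2 \<or> ?P4 \<or> ?C4 \<or> ?E1 \<or> ?E3 \<or> ?E4 \<or> ?KK \<or> ?K11)")
proof -
  interpret pair_graph G by fact
  have zero: "dmg G 2 = 0" if "?P2 \<or> ?E1"
    using that
  proof
    assume ?P2
    then obtain g where g: "pverts G = g ` pverts (path_graph 2)"
      "\<And>x y. x \<in> pverts (path_graph 2) \<Longrightarrow> y \<in> pverts (path_graph 2) \<Longrightarrow>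
        (g x, g y) \<in> parcs G \<longleftrightarrow> (x, y) \<in> parcs (path_graph 2)"
      by (rule isomorphicE) blast
    have "pverts G = {g 0, g 1}" unfolding g(1) by (auto simp: path_graph_def less_2_cases_iff)
    moreover have "g 1 \<in> closed_nbhd G (g 0)"
      using g(2)[of 0 1] by (simp add: closed_nbhd_def path_graph_def)
    ultimately show ?thesis by (rule dmg_eq_zeroI)
  next
    assume ?E1
    then obtain g :: "nat \<Rightarrow> 'a" where "pverts G = g ` pverts (edgeless_graph 1)"
      by (rule isomorphicE) blast
    then have "pverts G = {g 0, g 0}" by (simp add: edgeless_graph_def lessThan_Suc)
    then show ?thesis by (rule dmg_eq_zeroI) (simp add: closed_nbhd_def)
  qed
  have two: "2 \<le> dmg G 2" if "?P4 \<or> ?C4 \<or> ?E3 \<or> ?E4 \<or> ?KK \<or> ?K11"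
  proof (rule dmg_ge_twoI[OF assms(2)])
    fix c assume "c \<in> pverts G"
    then show "two_damageable_from G c"
      using that two_damageable_from_path_4 two_damageable_from_cycle_4
        two_damageable_from_edgeless[of 3] two_damageable_from_edgeless[of 4]
        two_damageable_from_two_edges two_damageable_from_edge_and_two_points
      by (elim disjE) (erule two_damageable_from_iso; simp)+
  qed
  have one: "dmg G 2 = 1"
    if small: "\<not> ?P2" "\<not> ?E1" and big: "\<not> (?P4 \<or> ?C4 \<or> ?E3 \<or> ?E4 \<or> ?KK \<or> ?K11)"
  proof (rule antisym)
    obtain c d where "c \<in> pverts G" "\<And>x. x \<in> pverts G \<Longrightarrow> x \<notin> closed_nbhd G c \<Longrightarrow> x = d \<and> isolated d"
      using exceptional_if_no_dominating_start[OF assms(2,3)] big by blast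
    then show "dmg G 2 \<le> 1" by (rule dmg_le_oneI[OF assms(3)])
    show "1 \<le> dmg G 2"
    proof (rule dmg_ge_oneI[OF assms(2)])
      fix c assume c: "c \<in> pverts G"
      show "\<exists>u\<in>pverts G. \<exists>v\<in>pverts G. u \<noteq> c \<and> v \<noteq> c \<and> (u \<noteq> v \<or> u \<notin> closed_nbhd G c)"
      proof (rule ccontr)
        \<comment> \<open>Then at most one vertex besides \<open>c\<close> exists, and it is
          adjacent to \<open>c\<close>: the graph is a single vertex or a single edge.\<close>
        assume *: "\<not> ?thesis"
        show False
        proof (cases "pverts G = {c}")
          case True
          then have "parcs G = {}" using in_arcsD1 in_arcsD2 no_loops' by fastforce
          then show False using iso_edgeless True small(2) by fastforce
        next
          case False
          then obtain u where u: "u \<in> pverts G" "u \<noteq> c" using c by blast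
          then have "pverts G = {c, u}" using * c by blast
          moreover have "(c, u) \<in> parcs G" using * u by (auto simp: closed_nbhd_def)
          ultimately show False using iso_path_2 small(1) by blast
        qed
      qed
    qed
  qed
  show ?thesis using zero two one by fastforce
qed

end
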